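(* Let $I$ be an infinite set and $\beta : I \to I$. Then there exist $G : \mathcal{P}_{\omega,*}(I) \to \mathcal{P}_{\omega,*}(I)$ and $v : \mathcal{P}_{\omega,*}(I) \to I$ such that $P_1(\beta,G,v)$ holds if and only if $\widetilde{P}(\beta)$ holds.
   Context: $\mathcal{P}_{\omega,*}(I)$ is the set of finite non-empty subsets of $I$. For a self-map $\phi$ of $I$ and $a \in I$, $\mathcal{O}^+_\phi(a) = \{\phi^n(a) : n \in \mathbb{N}\}$, with $\mathbb{N} = \{0,1,2,\dots\}$ and $\phi^0 = \mathrm{Id}$. Property $P_1(\phi,G,u)$, for $\phi : I \to I$, $G : \mathcal{P}_{\omega,*}(I) \to \mathcal{P}_{\omega,*}(I)$, $u : \mathcal{P}_{\omega,*}(I) \to I$: for all $I^* \in \mathcal{P}_{\omega,*}(I)$, $u(I^* ) \in G(I^* )$, $I^* \subseteq G(I^* )$ and $\phi(G(I^* ) \setminus \{u(I^* )\}) \subseteq G(I^* )$. Property $\widetilde{P}(\phi)$: for all $a,b \in I$, if $|\mathcal{O}^+_\phi(a)| = |\mathcal{O}^+_\phi(b)| = \infty$ (both orbits are infinite), then $\mathcal{O}^+_\phi(a) \cap \mathcal{O}^+_\phi(b)$ is infinite. *)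

theory Defs
  imports Main "HOL-Library.FuncSet"
begin

definition fin_ne_subsets :: "'a set \<Rightarrow> 'a set set" where
  "fin_ne_subsets I = {A. A \<subseteq> I \<and> finite A \<and> A \<noteq> {}}"

definition forward_orbit :: "('a \<Rightarrow> 'a) \<Rightarrow> 'a \<Rightarrow> 'a set" where
  "forward_orbit \<phi> a = {(\<phi> ^^ n) a |n::nat. True}"

definition P1 :: "'a set \<Rightarrow> ('a \<Rightarrow> 'a) \<Rightarrow> ('a set \<Rightarrow> 'a set) \<Rightarrow> ('a set \<Rightarrow> 'a) \<Rightarrow> bool" where
  "P1 I \<phi> G u \<longleftrightarrow>
    (\<forall>J\<in>fin_ne_subsets I. u J \<in> G J \<and> J \<subseteq> G J \<and> \<phi> ` (G J - {u J}) \<subseteq> G J)"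

definition P_tilde :: "'a set \<Rightarrow> ('a \<Rightarrow> 'a) \<Rightarrow> bool" where
  "P_tilde I \<phi> \<longleftrightarrow>
    (\<forall>a\<in>I. \<forall>b\<in>I. infinite (forward_orbit \<phi> a) \<and> infinite (forward_orbit \<phi> b) \<longrightarrow>
      infinite (forward_orbit \<phi> a \<inter> forward_orbit \<phi> b))"

end

theory Submission
  imports Defs
begin

text \<open>
  A finite set that is stable under \<open>\<beta>\<close> except at one point \<open>u\<close> can be left only through \<open>u\<close>, so every
  infinite orbit starting in it passes through \<open>u\<close>; two such orbits therefore share the infinite
  orbit of \<open>u\<close>. Conversely, if any two infinite orbits meet, then finitely many of them have a common
  point \<open>u\<close>, and a suitable \<open>G J\<close> consists of the finite orbits from \<open>J\<close> together with the initial
  segments up to \<open>u\<close> of the infinite ones.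
\<close>

lemma forward_orbit_iff: "x \<in> forward_orbit f a \<longleftrightarrow> (\<exists>n. x = (f ^^ n) a)"
  by (auto simp: forward_orbit_def)

lemma forward_orbit_self: "a \<in> forward_orbit f a"
  unfolding forward_orbit_iff by (rule exI[of _ 0]) simp

lemma forward_orbit_step: "x \<in> forward_orbit f a \<Longrightarrow> f x \<in> forward_orbit f a"
  unfolding forward_orbit_iff by (metis comp_apply funpow.simps(2))

lemma forward_orbit_subset_invariant:
  assumes "a \<in> A" and "f ` A \<subseteq> A"
  shows "forward_orbit f a \<subseteq> A"
proof -
  have "(f ^^ n) a \<in> A" for n
    using assms by (induction n) auto
  then show ?thesis by (auto simp: forward_orbit_iff)
qed

lemma forward_orbit_trans:
  "x \<in> forward_orbit f a \<Longrightarrow> forward_orbit f x \<subseteq> forward_orbit f a"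
  by (rule forward_orbit_subset_invariant) (auto intro: forward_orbit_step)

text \<open>Only finitely many points of the orbit of \<open>a\<close> come before its first arrival
  at a fixed index \<open>n\<close> with \<open>x = (f ^^ n) a\<close>; all the others lie on the
  orbit of \<open>x\<close>.\<close>

lemma infinite_forward_orbit_tail:
  assumes "infinite (forward_orbit f a)" and "x \<in> forward_orbit f a"
  shows "infinite (forward_orbit f x)"
proof
  assume fin: "finite (forward_orbit f x)"
  obtain n where x: "x = (f ^^ n) a" using assms(2) unfolding forward_orbit_iff by blast
  have "(f ^^ k) a \<in> (\<lambda>k. (f ^^ k) a) ` {..<n} \<union> forward_orbit f x" for k
  proof (cases "k < n")
    case False
    then have "(f ^^ k) a = (f ^^ (k - n)) x"
      using fun_cong[OF funpow_add[of "k - n" n f], of a] by (simp add: x)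
    then show ?thesis by (auto simp: forward_orbit_iff)
  qed auto
  then have "forward_orbit f a \<subseteq> (\<lambda>k. (f ^^ k) a) ` {..<n} \<union> forward_orbit f x"
    by (force simp: forward_orbit_iff)
  with fin assms(1) show False
    by (meson finite_UnI finite_imageI finite_lessThan finite_subset)
qed

text \<open>If the orbit avoided \<open>u\<close>, then \<open>A \<inter> forward_orbit f a\<close>
  would be invariant under \<open>f\<close> and contain \<open>a\<close>, so the whole orbit would
  be trapped in the finite set \<open>A\<close>.\<close>

lemma infinite_forward_orbit_exit:
  assumes "infinite (forward_orbit f a)" and "finite A" and "a \<in> A" and "f ` (A - {u}) \<subseteq> A"
  shows "u \<in> forward_orbit f a"
proof (rule ccontr)
  assume u: "u \<notin> forward_orbit f a"
  have "forward_orbit f a \<subseteq> A \<inter> forward_orbit f a"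
    using assms(3,4) u
    by (intro forward_orbit_subset_invariant)
       (auto intro: forward_orbit_self forward_orbit_step)
  then show False using assms(1,2) by (metis finite_Int finite_subset)
qed

text \<open>This builds the piece of \<open>G J\<close> that belongs to a single point
  \<open>b\<close>. A finite orbit is invariant as a whole, so \<open>u\<close> has to lie on the
  orbit only when it is infinite.\<close>

lemma finite_subset_forward_orbit_invariant_except:
  assumes "infinite (forward_orbit f b) \<longrightarrow> u \<in> forward_orbit f b"
  shows "\<exists>A. finite A \<and> A \<subseteq> forward_orbit f b \<and> b \<in> A \<and> f ` (A - {u}) \<subseteq> A"
proof (cases "finite (forward_orbit f b)")
  case True
  then show ?thesis
    by (intro exI[of _ "forward_orbit f b"])
       (auto intro: forward_orbit_self forward_orbit_step)
next
  case False
  then obtain m where m: "u = (f ^^ m) b" using assms unfolding forward_orbit_iff by blast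
  let ?A = "(\<lambda>k. (f ^^ k) b) ` {..m}"
  have "f ((f ^^ k) b) \<in> ?A" if "k \<le> m" "(f ^^ k) b \<noteq> u" for k
  proof (rule image_eqI)
    show "f ((f ^^ k) b) = (f ^^ Suc k) b" by simp
    \<comment> \<open>Only the last index \<open>m\<close> could lead out of the segment, and its
      point is the exempted \<open>u\<close>.\<close>
    have "k \<noteq> m" using that(2) m by auto
    then show "Suc k \<in> {..m}" using that(1) by simp
  qed
  moreover have "b \<in> ?A" by (rule image_eqI[of _ _ 0]) auto
  ultimately show ?thesis
    by (intro exI[of _ ?A]) (auto simp: forward_orbit_iff)
qed

text \<open>Keeping the common point on one fixed infinite orbit makes the induction on
  \<open>J\<close> work: the point then lies in \<open>I\<close> and has an infinite orbit itself,
  so \<open>P_tilde\<close> can be applied to it and the next element of \<open>J\<close>.\<close>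

lemma P_tilde_common_point_from:
  assumes P: "P_tilde I f" and f: "f \<in> I \<rightarrow> I" and "finite J" and "J \<subseteq> I"
    and a: "a \<in> I" "infinite (forward_orbit f a)"
  shows "\<exists>u\<in>forward_orbit f a. \<forall>b\<in>J. infinite (forward_orbit f b) \<longrightarrow> u \<in> forward_orbit f b"
  using assms(3,4)
proof (induction J rule: finite_induct)
  case empty
  then show ?case by (auto intro: forward_orbit_self)
next
  case (insert b J)
  then obtain u where u: "u \<in> forward_orbit f a"
    and uJ: "\<forall>c\<in>J. infinite (forward_orbit f c) \<longrightarrow> u \<in> forward_orbit f c" by auto
  have "u \<in> I" using u a(1) f forward_orbit_subset_invariant[of a I f] by auto
  moreover have "infinite (forward_orbit f u)" using a(2) u by (rule infinite_forward_orbit_tail)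
  \<comment> \<open>If the orbit of \<open>b\<close> is infinite, it meets that of \<open>u\<close>
    by \<open>P_tilde\<close>, and \<open>w\<close> is a meeting point; otherwise
    \<open>w = u\<close> will do.\<close>
  ultimately obtain w where w: "w \<in> forward_orbit f u"
    and wb: "infinite (forward_orbit f b) \<longrightarrow> w \<in> forward_orbit f b"
    using P insert.prems forward_orbit_self[of u f] unfolding P_tilde_def
    by (metis Int_iff all_not_in_conv finite.emptyI insert_subset)
  \<comment> \<open>Moving forward from \<open>u\<close> to \<open>w\<close> leaves none of the
    orbits already treated.\<close>
  have "w \<in> forward_orbit f c" if "u \<in> forward_orbit f c" for c
    using forward_orbit_trans[OF that] w by auto
  with u uJ wb show ?case by (intro bexI[of _ w]) auto
qed

lemma P_tilde_common_point:
  assumes "P_tilde I f" and "f \<in> I \<rightarrow> I" and "J \<in> fin_ne_subsets I"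
  shows "\<exists>u\<in>I. \<forall>b\<in>J. infinite (forward_orbit f b) \<longrightarrow> u \<in> forward_orbit f b"
proof (cases "\<exists>a\<in>J. infinite (forward_orbit f a)")
  case True
  then obtain a where a: "a \<in> I" "infinite (forward_orbit f a)"
    using assms(3) by (auto simp: fin_ne_subsets_def)
  have "forward_orbit f a \<subseteq> I"
    using a(1) assms(2) by (intro forward_orbit_subset_invariant) auto
  with P_tilde_common_point_from[OF assms(1,2) _ _ a, of J] assms(3) show ?thesis
    by (auto simp: fin_ne_subsets_def)
next
  case False
  \<comment> \<open>The condition on \<open>u\<close> is vacuous here, so any element of the
    nonempty set \<open>J\<close> serves.\<close>
  then show ?thesis using assms(3) by (auto simp: fin_ne_subsets_def)
qed

lemma P_tilde_imp_finite_superset_invariant_except: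
  assumes "P_tilde I f" and f: "f \<in> I \<rightarrow> I" and J: "J \<in> fin_ne_subsets I"
  shows "\<exists>A u. A \<in> fin_ne_subsets I \<and> u \<in> A \<and> J \<subseteq> A \<and> f ` (A - {u}) \<subseteq> A"
proof -
  obtain u where "u \<in> I"
    and u: "\<forall>b\<in>J. infinite (forward_orbit f b) \<longrightarrow> u \<in> forward_orbit f b"
    using P_tilde_common_point[OF assms] by blast
  have "\<forall>b\<in>J. \<exists>A. finite A \<and> A \<subseteq> forward_orbit f b \<and> b \<in> A \<and> f ` (A - {u}) \<subseteq> A"
    using u finite_subset_forward_orbit_invariant_except by fast
  then obtain g where g: "\<forall>b\<in>J. finite (g b) \<and> g b \<subseteq> forward_orbit f b \<and> b \<in> g b
      \<and> f ` (g b - {u}) \<subseteq> g b"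
    by metis
  have "forward_orbit f b \<subseteq> I" if "b \<in> J" for b
    using that J f by (intro forward_orbit_subset_invariant) (auto simp: fin_ne_subsets_def)
  then have "(\<Union>b\<in>J. g b) \<subseteq> I" using g by blast
  moreover have "finite (\<Union>b\<in>J. g b)" using g J by (simp add: fin_ne_subsets_def)
  \<comment> \<open>All pieces share the exceptional point \<open>u\<close>, so their union is still
    stable away from it. The point is inserted by hand because no piece is known to contain it when
    all orbits from \<open>J\<close> are finite.\<close>
  ultimately have "insert u (\<Union>b\<in>J. g b) \<in> fin_ne_subsets I"
    using \<open>u \<in> I\<close> by (simp add: fin_ne_subsets_def)
  moreover have "f ` (insert u (\<Union>b\<in>J. g b) - {u}) \<subseteq> insert u (\<Union>b\<in>J. g b)"
    using g by blast
  moreover have "J \<subseteq> insert u (\<Union>b\<in>J. g b)" using g by blast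
  ultimately show ?thesis by (intro exI[of _ "insert u (\<Union>b\<in>J. g b)"] exI[of _ u]) simp
qed

lemma P1_imp_P_tilde:
  assumes G: "G \<in> fin_ne_subsets I \<rightarrow> fin_ne_subsets I" and P: "P1 I f G v"
  shows "P_tilde I f"
  unfolding P_tilde_def
proof (intro ballI impI)
  fix a b
  assume ab: "a \<in> I" "b \<in> I" and inf: "infinite (forward_orbit f a) \<and> infinite (forward_orbit f b)"
  \<comment> \<open>Both orbits start in the one finite set \<open>G ?J\<close>, so both must pass
    through the same point \<open>v ?J\<close>.\<close>
  let ?J = "{a, b}"
  have J: "?J \<in> fin_ne_subsets I" using ab by (simp add: fin_ne_subsets_def)
  then have "finite (G ?J)" using G by (auto simp: fin_ne_subsets_def)
  moreover have "?J \<subseteq> G ?J" "f ` (G ?J - {v ?J}) \<subseteq> G ?J"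
    using P J by (auto simp: P1_def)
  ultimately have v: "v ?J \<in> forward_orbit f a" "v ?J \<in> forward_orbit f b"
    using inf by (auto intro: infinite_forward_orbit_exit)
  then have "forward_orbit f (v ?J) \<subseteq> forward_orbit f a \<inter> forward_orbit f b"
    by (simp add: forward_orbit_trans)
  moreover have "infinite (forward_orbit f (v ?J))"
    using inf v(1) infinite_forward_orbit_tail by metis
  ultimately show "infinite (forward_orbit f a \<inter> forward_orbit f b)"
    using finite_subset by blast
qed

theorem proposition7p2:
  fixes I :: "'a set" and \<beta> :: "'a \<Rightarrow> 'a"
  assumes "infinite I" and "\<beta> \<in> I \<rightarrow> I"
  shows "(\<exists>G \<in> fin_ne_subsets I \<rightarrow> fin_ne_subsets I. \<exists>v \<in> fin_ne_subsets I \<rightarrow> I. P1 I \<beta> G v)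
    \<longleftrightarrow> P_tilde I \<beta>"
proof
  assume "\<exists>G \<in> fin_ne_subsets I \<rightarrow> fin_ne_subsets I. \<exists>v \<in> fin_ne_subsets I \<rightarrow> I. P1 I \<beta> G v"
  then show "P_tilde I \<beta>" by (blast intro: P1_imp_P_tilde)
next
  assume "P_tilde I \<beta>"
  then have "\<forall>J\<in>fin_ne_subsets I. \<exists>A u. A \<in> fin_ne_subsets I \<and> u \<in> A \<and> J \<subseteq> A
      \<and> \<beta> ` (A - {u}) \<subseteq> A"
    using P_tilde_imp_finite_superset_invariant_except[OF _ assms(2)] by simp
  \<comment> \<open>The axiom of choice turns the pairs found for each \<open>J\<close> into two
    functions.\<close>
  then obtain G v where Gv: "\<forall>J\<in>fin_ne_subsets I. G J \<in> fin_ne_subsets I \<and> v J \<in> G J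
      \<and> J \<subseteq> G J \<and> \<beta> ` (G J - {v J}) \<subseteq> G J"
    by metis
  then have "G \<in> fin_ne_subsets I \<rightarrow> fin_ne_subsets I" by blast
  moreover have "v \<in> fin_ne_subsets I \<rightarrow> I"
  proof
    fix J assume "J \<in> fin_ne_subsets I"
    with Gv have "v J \<in> G J" "G J \<subseteq> I" by (simp_all add: fin_ne_subsets_def)
    then show "v J \<in> I" by blast
  qed
  moreover from Gv have "P1 I \<beta> G v"
    by (simp add: P1_def)
  ultimately show
    "\<exists>G \<in> fin_ne_subsets I \<rightarrow> fin_ne_subsets I. \<exists>v \<in> fin_ne_subsets I \<rightarrow> I. P1 I \<beta> G v"
    by blast
qed

end
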